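(* Let $n\ge 2$ be an integer. Then $\mathcal{B}(n+1,n)\le\binom{n}{2}$ if $n$ is odd, and $\mathcal{B}(n+1,n)\le\binom{n}{2}-1$ if $n$ is even.
   Context: An orthogonal array $\mathrm{OA}(k,n)$ on an alphabet $\Lambda$ with $|\Lambda|=n$ is an $n^2\times k$ matrix $A=(a_{r\ell})$ with entries in $\Lambda$ such that in every pair of distinct columns each ordered pair in $\Lambda^2$ occurs in exactly one row. For distinct columns $c,i,j\in\{1,\dots,k\}$ and $s\in\Lambda$, let $\rho_s(c,i,j)$ be the permutation of $\Lambda$ mapping $a_{ri}\mapsto a_{rj}$ for all rows $r$ with $a_{rc}=s$. With $\pi(\gamma)\in\mathbb{Z}_2$ denoting the parity of a permutation $\gamma$ ($0$ for even, $1$ for odd), define $\tau^c_{ij}(A)=\sum_{s\in\Lambda}\pi(\rho_s(c,i,j))\in\mathbb{Z}_2$. The $\tau$-parity of $A$ is the vector $(\tau^c_{ij}(A))$ indexed by the $k(k-1)(k-2)$ ordered triples $(c,i,j)$ of distinct elements of $\{1,\dots,k\}$. $\mathcal{B}(k,n)$ denotes $\log_2$ of the number of different $\tau$-parities achieved by orthogonal arrays $\mathrm{OA}(k,n)$ (on a fixed alphabet of size $n$); if no $\mathrm{OA}(k,n)$ exists we use the convention $\log_2 0=-\infty$. *)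

theory Defs
  imports
    Complex_Main
    "HOL-Library.Extended_Real"
    "HOL-Library.FuncSet"
    "HOL-Library.Z2"
    "HOL-Combinatorics.Permutations"
begin

text \<open>
  An array is a function \<open>A\<close> with \<open>A r l\<close> the entry in row \<open>r\<close> and column \<open>l\<close>. Only the
  entries with \<open>r \<in> {1..n\<^sup>2}\<close> and \<open>l \<in> {1..k}\<close> are meaningful; nothing below looks at the others.
\<close>

definition orthogonal_array :: "nat \<Rightarrow> nat \<Rightarrow> 'a set \<Rightarrow> (nat \<Rightarrow> nat \<Rightarrow> 'a) \<Rightarrow> bool" where
  "orthogonal_array k n \<Lambda> A \<longleftrightarrow>
     finite \<Lambda> \<and> card \<Lambda> = n \<and>
     (\<forall>r\<in>{1..n^2}. \<forall>l\<in>{1..k}. A r l \<in> \<Lambda>) \<and>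
     (\<forall>i\<in>{1..k}. \<forall>j\<in>{1..k}. i \<noteq> j \<longrightarrow>
        (\<forall>x\<in>\<Lambda>. \<forall>y\<in>\<Lambda>. \<exists>!r. r \<in> {1..n^2} \<and> A r i = x \<and> A r j = y))"

text \<open>
  The permutation of \<open>\<Lambda>\<close> is extended by the identity, as the library's \<open>permutes\<close> and
  \<open>evenperm\<close> expect. The description is proper by lemma \<open>rho_entry\<close> below.
\<close>

definition rho :: "nat \<Rightarrow> 'a set \<Rightarrow> (nat \<Rightarrow> nat \<Rightarrow> 'a) \<Rightarrow> 'a \<Rightarrow> nat \<Rightarrow> nat \<Rightarrow> nat \<Rightarrow> 'a \<Rightarrow> 'a" where
  "rho n \<Lambda> A s c i j x =
     (if x \<in> \<Lambda> then THE y. \<exists>r\<in>{1..n^2}. A r c = s \<and> A r i = x \<and> A r j = y else x)"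

definition perm_parity :: "('a \<Rightarrow> 'a) \<Rightarrow> bit" where
  "perm_parity p = (if evenperm p then 0 else 1)"

definition tau :: "nat \<Rightarrow> 'a set \<Rightarrow> (nat \<Rightarrow> nat \<Rightarrow> 'a) \<Rightarrow> nat \<Rightarrow> nat \<Rightarrow> nat \<Rightarrow> bit" where
  "tau n \<Lambda> A c i j = (\<Sum>s\<in>\<Lambda>. perm_parity (rho n \<Lambda> A s c i j))"

definition column_triples :: "nat \<Rightarrow> (nat \<times> nat \<times> nat) set" where
  "column_triples k =
     {(c, i, j). c \<in> {1..k} \<and> i \<in> {1..k} \<and> j \<in> {1..k} \<and> c \<noteq> i \<and> c \<noteq> j \<and> i \<noteq> j}"

definition tau_parity ::
  "nat \<Rightarrow> nat \<Rightarrow> 'a set \<Rightarrow> (nat \<Rightarrow> nat \<Rightarrow> 'a) \<Rightarrow> nat \<times> nat \<times> nat \<Rightarrow> bit" where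
  "tau_parity k n \<Lambda> A = (\<lambda>(c, i, j) \<in> column_triples k. tau n \<Lambda> A c i j)"

definition tau_parities :: "nat \<Rightarrow> nat \<Rightarrow> 'a set \<Rightarrow> (nat \<times> nat \<times> nat \<Rightarrow> bit) set" where
  "tau_parities k n \<Lambda> = tau_parity k n \<Lambda> ` {A. orthogonal_array k n \<Lambda> A}"

text \<open>
  The logarithm is extended-real valued because \<open>log 2 0 = 0\<close> in the library.
\<close>

definition \<B> :: "nat \<Rightarrow> nat \<Rightarrow> 'a set \<Rightarrow> ereal" where
  "\<B> k n \<Lambda> =
     (if tau_parities k n \<Lambda> = {} then - \<infinity>
      else ereal (log 2 (real (card (tau_parities k n \<Lambda>)))))"

lemma rho_entry:
  assumes "orthogonal_array k n \<Lambda> A" "(c, i, j) \<in> column_triples k"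
    and "r \<in> {1..n^2}" "A r c = s"
  shows "rho n \<Lambda> A s c i j (A r i) = A r j"
proof -
  have mem: "A r i \<in> \<Lambda>" "A r c \<in> \<Lambda>"
    using assms by (auto simp: orthogonal_array_def column_triples_def)
  have "\<exists>!r'. r' \<in> {1..n^2} \<and> A r' c = A r c \<and> A r' i = A r i"
    using assms mem by (auto simp: orthogonal_array_def column_triples_def)
  then have "r' = r" if "r' \<in> {1..n^2}" "A r' c = A r c" "A r' i = A r i" for r'
    using that assms(3) by blast
  then have "(THE y. \<exists>r'\<in>{1..n^2}. A r' c = s \<and> A r' i = A r i \<and> A r' j = y) = A r j"
    using assms(3,4) by (intro the_equality) blast+
  then show ?thesis using mem by (simp add: rho_def)
qed

lemma rho_permutes:
  assumes OA: "orthogonal_array k n \<Lambda> A" and T: "(c, i, j) \<in> column_triples k" and s: "s \<in> \<Lambda>"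
  shows "rho n \<Lambda> A s c i j permutes \<Lambda>"
proof (rule bij_imp_permutes)
  have fin: "finite \<Lambda>" using OA by (simp add: orthogonal_array_def)
  have "y \<in> rho n \<Lambda> A s c i j ` \<Lambda>" if y: "y \<in> \<Lambda>" for y
  proof -
    have "\<exists>!r. r \<in> {1..n^2} \<and> A r c = s \<and> A r j = y"
      using OA T s y by (auto simp: orthogonal_array_def column_triples_def)
    then obtain r where r: "r \<in> {1..n^2}" "A r c = s" "A r j = y" by blast
    then have "A r i \<in> \<Lambda>"
      using OA T by (auto simp: orthogonal_array_def column_triples_def)
    with rho_entry[OF OA T r(1,2)] r(3) show ?thesis by (metis image_eqI)
  qed
  moreover have "rho n \<Lambda> A s c i j x \<in> \<Lambda>" if x: "x \<in> \<Lambda>" for x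
  proof -
    have "\<exists>!r. r \<in> {1..n^2} \<and> A r c = s \<and> A r i = x"
      using OA T s x by (auto simp: orthogonal_array_def column_triples_def)
    then obtain r where r: "r \<in> {1..n^2}" "A r c = s" "A r i = x" by blast
    then have "A r j \<in> \<Lambda>"
      using OA T by (auto simp: orthogonal_array_def column_triples_def)
    with rho_entry[OF OA T r(1,2)] r(3) show ?thesis by simp
  qed
  ultimately have "rho n \<Lambda> A s c i j ` \<Lambda> = \<Lambda>" by blast
  then show "bij_betw (rho n \<Lambda> A s c i j) \<Lambda> \<Lambda>"
    using fin by (simp add: bij_betw_def eq_card_imp_inj_on)
qed (simp add: rho_def)

lemma finite_tau_parities: "finite (tau_parities k n \<Lambda>)"
proof -
  have "finite (column_triples k)"
    by (rule finite_subset[of _ "{1..k} \<times> {1..k} \<times> {1..k}"]) (auto simp: column_triples_def)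
  moreover have "UNIV = {0, 1 :: bit}" using bit_not_zero_iff by blast
  then have "finite (UNIV :: bit set)" by (metis finite.simps)
  ultimately have "finite (column_triples k \<rightarrow>\<^sub>E (UNIV :: bit set))" by (simp add: finite_PiE)
  then show ?thesis
    by (rule finite_subset[rotated]) (auto simp: tau_parities_def tau_parity_def)
qed

end

theory Submission
  imports Defs
begin

text \<open>
  Order the alphabet. Modulo 2, \<open>\<tau>\<^sup>c\<^sub>i\<^sub>j\<close> counts the unordered pairs of rows that agree in column \<open>c\<close>
  and are ordered differently by columns \<open>i\<close> and \<open>j\<close>. This gives
  \<open>\<tau>\<^sup>c\<^sub>i\<^sub>j = \<tau>\<^sup>c\<^sub>j\<^sub>i\<close> and \<open>\<tau>\<^sup>c\<^sub>i\<^sub>j + \<tau>\<^sup>c\<^sub>j\<^sub>l = \<tau>\<^sup>c\<^sub>i\<^sub>l\<close>. Let \<open>d\<^sub>i\<^sub>j\<close> count the pairs of rows that differ in both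
  \<open>i\<close> and \<open>j\<close> and are ordered differently by them; since \<open>(i, j)\<close> identifies the rows with
  \<open>\<Lambda> \<times> \<Lambda>\<close>, it is the same for all arrays. Three columns can
  disagree about a pair of rows only an even number of times, so
  \<open>\<tau>\<^sup>c\<^sub>i\<^sub>j + \<tau>\<^sup>i\<^sub>c\<^sub>j + \<tau>\<^sup>j\<^sub>c\<^sub>i = d\<^sub>i\<^sub>j + d\<^sub>c\<^sub>j + d\<^sub>c\<^sub>i\<close>. If there are \<open>n + 1\<close> columns, any two rows agree in
  exactly one of them, so \<open>\<Sum>\<^sub>c \<tau>\<^sup>c\<^sub>i\<^sub>j = d\<^sub>i\<^sub>j\<close>.

  With \<open>K = n + 1\<close>, these affine relations determine all of \<open>\<tau>\<close> from the \<open>\<tau>\<^sup>i\<^sub>K\<^sub>j\<close> with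
  \<open>2 \<le> i < j \<le> n\<close> and the \<open>\<tau>\<^sup>K\<^sub>1\<^sub>j\<close> with \<open>2 \<le> j \<le> n\<close>, and for even \<open>n\<close> they also determine \<open>\<tau>\<^sup>K\<^sub>1\<^sub>n\<close>
  from the others.
\<close>

section \<open>Arithmetic modulo 2\<close>

lemma bit_add_eq_0_iff: "x + y = 0 \<longleftrightarrow> x = (y :: bit)"
  by (cases x; cases y) simp_all

lemma card_bit: "card (UNIV :: bit set) = 2"
proof -
  have "UNIV = {0, 1 :: bit}" using bit_not_zero_iff by blast
  moreover have "card {0, 1 :: bit} = 2" by simp
  ultimately show ?thesis by metis
qed

subsection \<open>Sums over unordered pairs\<close>

text \<open>The order on the indices only serves to take each unordered pair once; for
  \<open>\<phi>\<close> symmetric off the diagonal the value does not depend on it.\<close>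

definition pair_sum :: "'i::linorder set \<Rightarrow> ('i \<Rightarrow> 'i \<Rightarrow> 'b::comm_monoid_add) \<Rightarrow> 'b" where
  "pair_sum R \<phi> = (\<Sum>r\<in>R. \<Sum>r'\<in>R. if r < r' then \<phi> r r' else 0)"

lemma pair_sum_cong:
  assumes "\<And>r r'. r \<in> R \<Longrightarrow> r' \<in> R \<Longrightarrow> r \<noteq> r' \<Longrightarrow> \<phi> r r' = \<psi> r r'"
  shows "pair_sum R \<phi> = pair_sum R \<psi>"
  unfolding pair_sum_def using assms by (intro sum.cong) auto

lemma pair_sum_add:
  "pair_sum R (\<lambda>r r'. \<phi> r r' + \<psi> r r') = pair_sum R \<phi> + pair_sum R \<psi>"
proof -
  have "(if r < r' then \<phi> r r' + \<psi> r r' else 0) =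
      (if r < r' then \<phi> r r' else 0) + (if r < r' then \<psi> r r' else 0)" for r r'
    by simp
  then show ?thesis
    unfolding pair_sum_def by (simp only: sum.distrib)
qed

lemma pair_sum_sum:
  "pair_sum R (\<lambda>r r'. \<Sum>c\<in>C. \<phi> c r r') = (\<Sum>c\<in>C. pair_sum R (\<phi> c))"
proof (cases "finite C")
  case True
  then show ?thesis
    by induction (simp_all add: pair_sum_add, simp add: pair_sum_def)
qed (simp add: pair_sum_def)

text \<open>Symmetry allows every pair containing \<open>x\<close> to be written with
  \<open>x\<close> first, wherever \<open>x\<close> stands in the order.\<close>

lemma pair_sum_insert:
  assumes R: "finite R" "x \<notin> R"
    and sym: "\<And>r. r \<in> R \<Longrightarrow> \<phi> r x = \<phi> x r"
  shows "pair_sum (insert x R) \<phi> = (\<Sum>r\<in>R. \<phi> x r) + pair_sum R \<phi>"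
proof -
  have "pair_sum (insert x R) \<phi> =
      (\<Sum>r\<in>R. if x < r then \<phi> x r else 0) +
      ((\<Sum>r\<in>R. if r < x then \<phi> r x else 0) + pair_sum R \<phi>)"
    using R by (simp add: pair_sum_def sum.distrib add.left_commute)
  also have "\<dots> = (\<Sum>r\<in>R. (if x < r then \<phi> x r else 0) + (if r < x then \<phi> r x else 0)) + pair_sum R \<phi>"
    by (simp add: sum.distrib add.assoc)
  also have "(\<Sum>r\<in>R. (if x < r then \<phi> x r else 0) + (if r < x then \<phi> r x else 0)) = (\<Sum>r\<in>R. \<phi> x r)"
  proof (intro sum.cong refl)
    fix r assume "r \<in> R"
    then show "(if x < r then \<phi> x r else 0) + (if r < x then \<phi> r x else 0) = \<phi> x r"
      using R sym[of r] by (cases x r rule: linorder_cases) auto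
  qed
  finally show ?thesis .
qed

text \<open>The map \<open>g\<close> may reverse the order of some pairs; symmetry of
  \<open>\<phi>\<close> absorbs this.\<close>

lemma pair_sum_reindex:
  assumes "finite R" "inj_on g R"
    and "\<And>r r'. r \<in> g ` R \<Longrightarrow> r' \<in> g ` R \<Longrightarrow> r \<noteq> r' \<Longrightarrow> \<phi> r r' = \<phi> r' r"
  shows "pair_sum (g ` R) \<phi> = pair_sum R (\<lambda>r r'. \<phi> (g r) (g r'))"
  using assms
proof (induction R)
  case empty
  then show ?case by (simp add: pair_sum_def)
next
  case (insert x R)
  have x: "g x \<notin> g ` R" using insert by auto
  have sym: "\<phi> (g r) (g x) = \<phi> (g x) (g r)" if "r \<in> R" for r
    using that insert.prems(2) x by (metis image_eqI insert_iff)
  have "pair_sum (g ` R) \<phi> = pair_sum R (\<lambda>r r'. \<phi> (g r) (g r'))"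
    using insert.prems by (intro insert.IH) auto
  moreover have "(\<Sum>r\<in>g ` R. \<phi> (g x) r) = (\<Sum>r\<in>R. \<phi> (g x) (g r))"
    using insert.prems(1) by (simp add: sum.reindex)
  moreover have "pair_sum (insert (g x) (g ` R)) \<phi> = (\<Sum>r\<in>g ` R. \<phi> (g x) r) + pair_sum (g ` R) \<phi>"
    using insert.hyps x sym by (intro pair_sum_insert) auto
  moreover have "pair_sum (insert x R) (\<lambda>r r'. \<phi> (g r) (g r')) =
      (\<Sum>r\<in>R. \<phi> (g x) (g r)) + pair_sum R (\<lambda>r r'. \<phi> (g r) (g r'))"
    using insert.hyps sym by (intro pair_sum_insert) auto
  ultimately show ?case by simp
qed

lemma pair_sum_fibres:
  assumes "finite R" "finite S" "g ` R \<subseteq> S"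
  shows "(\<Sum>s\<in>S. pair_sum {r \<in> R. g r = s} \<phi>) = pair_sum R (\<lambda>r r'. if g r = g r' then \<phi> r r' else 0)"
proof -
  let ?h = "\<lambda>r. \<Sum>r'\<in>{r' \<in> R. g r' = g r}. if r < r' then \<phi> r r' else 0"
  have "(\<Sum>s\<in>S. pair_sum {r \<in> R. g r = s} \<phi>) = (\<Sum>s\<in>S. sum ?h {r \<in> R. g r = s})"
    unfolding pair_sum_def by (intro sum.cong refl) auto
  also have "\<dots> = sum ?h R"
    using assms by (rule sum.group)
  also have "\<dots> = (\<Sum>r\<in>R. \<Sum>r'\<in>R. if g r' = g r then if r < r' then \<phi> r r' else 0 else 0)"
    using assms(1) by (simp add: sum.inter_filter)
  also have "\<dots> = pair_sum R (\<lambda>r r'. if g r = g r' then \<phi> r r' else 0)"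
    unfolding pair_sum_def by (intro sum.cong refl) auto
  finally show ?thesis .
qed

subsection \<open>Parity as a number of order changes\<close>

text \<open>Addition in \<open>bit\<close> is exclusive or, so without ties this is 1 exactly when
  \<open>u\<close> and \<open>v\<close> order \<open>r\<close> and \<open>r'\<close> differently.
  Writing it as a sum makes composition a cancellation of the middle term.\<close>

definition order_change :: "('i \<Rightarrow> 'k::linorder) \<Rightarrow> ('i \<Rightarrow> 'k) \<Rightarrow> 'i \<Rightarrow> 'i \<Rightarrow> bit" where
  "order_change u v r r' = of_bool (u r < u r') + of_bool (v r < v r')"

lemma order_change_self [simp]: "order_change u u r r' = 0"
  by (simp add: order_change_def)

lemma order_change_commute: "order_change u v = order_change v u"
  by (simp add: order_change_def fun_eq_iff add.commute)

lemma order_change_trans: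
  "order_change u v r r' + order_change v w r r' = order_change u w r r'"
  by (simp add: order_change_def of_bool_def)

text \<open>Without ties, exchanging \<open>r\<close> and \<open>r'\<close> flips both indicators,
  and the two flips cancel modulo 2.\<close>

lemma order_change_sym:
  assumes "u r \<noteq> u r'" "v r \<noteq> v r'"
  shows "order_change u v r r' = order_change u v r' r"
  using assms by (auto simp: order_change_def of_bool_def)

text \<open>Let \<open>x\<close> and \<open>y\<close> be the indices labelled \<open>a\<close> and
  \<open>b\<close>. For any other \<open>r\<close>, the changes at \<open>x, r\<close> and at
  \<open>y, r\<close> are both \<open>[f a < f (w r)] + [f b < f (w r)]\<close> and cancel. Pairs
  avoiding \<open>x\<close> and \<open>y\<close> do not change, so only the pair \<open>x, y\<close>
  is left.\<close>

lemma pair_sum_order_change_transpose: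
  fixes R :: "'i::linorder set" and f :: "'a \<Rightarrow> 'k::linorder"
  assumes fin: "finite R" and w: "bij_betw w R S" and f: "inj_on f S"
    and ab: "a \<in> S" "b \<in> S" "a \<noteq> b"
  shows "pair_sum R (order_change (f \<circ> w) (f \<circ> Transposition.transpose a b \<circ> w)) = 1"
proof -
  define \<phi> where "\<phi> = order_change (f \<circ> w) (f \<circ> Transposition.transpose a b \<circ> w)"
  obtain x y where xy: "x \<in> R" "w x = a" "y \<in> R" "w y = b"
    using w ab by (metis bij_betw_def imageE)
  have "x \<noteq> y" using xy ab by auto
  define Q where "Q = R - {x, y}"
  have R: "R = insert x (insert y Q)" using xy by (auto simp: Q_def)
  have winj: "w r = w r' \<longleftrightarrow> r = r'" if "r \<in> R" "r' \<in> R" for r r'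
    using w that by (auto simp: bij_betw_def inj_on_eq_iff)
  have wS: "w r \<in> S" if "r \<in> R" for r
    using w that by (auto simp: bij_betw_def)
  have finj: "f s = f s' \<longleftrightarrow> s = s'" if "s \<in> S" "s' \<in> S" for s s'
    using f that by (auto simp: inj_on_eq_iff)
  have tS: "Transposition.transpose a b s \<in> S" if "s \<in> S" for s
    using that ab by (auto simp: transpose_def)
  have sym: "\<phi> r r' = \<phi> r' r" if "r \<in> R" "r' \<in> R" "r \<noteq> r'" for r r'
    unfolding \<phi>_def using that
    by (intro order_change_sym) (simp_all add: finj wS winj tS inj_eq[OF inj_transpose])
  have Q: "finite Q" "x \<notin> insert y Q" "y \<notin> Q"
    using fin \<open>x \<noteq> y\<close> by (auto simp: Q_def)
  have fix_Q: "Transposition.transpose a b (w r) = w r" if "r \<in> Q" for r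
    using that xy winj by (intro transpose_apply_other) (auto simp: Q_def)
  have "pair_sum R \<phi> = (\<Sum>r\<in>insert y Q. \<phi> x r) + pair_sum (insert y Q) \<phi>"
    unfolding R using Q sym R by (intro pair_sum_insert) auto
  also have "\<dots> = \<phi> x y + (\<Sum>r\<in>Q. \<phi> x r) + ((\<Sum>r\<in>Q. \<phi> y r) + pair_sum Q \<phi>)"
    using Q sym R by (subst pair_sum_insert) auto
  also have "pair_sum Q \<phi> = pair_sum Q (\<lambda>_ _. 0)"
    by (intro pair_sum_cong) (simp add: \<phi>_def order_change_def fix_Q)
  also have "\<dots> = 0" by (simp add: pair_sum_def)
  also have "(\<Sum>r\<in>Q. \<phi> x r) = (\<Sum>r\<in>Q. \<phi> y r)"
    by (intro sum.cong) (simp_all add: \<phi>_def order_change_def fix_Q xy add.commute)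
  also have "\<phi> x y = 1"
    using finj[OF ab(1,2)] ab(3) by (auto simp: \<phi>_def order_change_def xy of_bool_def)
  finally show ?thesis by (simp add: \<phi>_def add.assoc)
qed

text \<open>The right side is the inversion count of \<open>p\<close> modulo 2, with
  \<open>u\<close> enumerating \<open>S\<close> and \<open>f\<close> supplying the order. Each
  transposition flips the parity and contributes 1 to the count; \<open>order_change_trans\<close>
  combines the successive contributions.\<close>

lemma perm_parity_eq_pair_sum:
  fixes R :: "'i::linorder set" and f :: "'a \<Rightarrow> 'k::linorder"
  assumes "p permutes S" "finite S"
    and u: "bij_betw u R S" and f: "inj_on f S"
  shows "perm_parity p = pair_sum R (order_change (f \<circ> u) (f \<circ> p \<circ> u))"
  using assms(1,2)
proof (induction rule: permutes_induct)
  case id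
  then show ?case by (simp add: perm_parity_def pair_sum_def)
next
  case (swap a b p)
  have R: "finite R" using u \<open>finite S\<close> by (simp add: bij_betw_finite)
  have w: "bij_betw (p \<circ> u) R S"
    using u swap.hyps by (blast intro: bij_betw_trans permutes_imp_bij)
  have "permutation p"
    using swap.hyps \<open>finite S\<close> by (auto simp: permutation_permutes)
  then have "perm_parity (Transposition.transpose a b \<circ> p) = perm_parity p + 1"
    using swap.hyps by (simp add: perm_parity_def evenperm_comp permutation_swap_id evenperm_swap)
  also have "\<dots> = pair_sum R (order_change (f \<circ> u) (f \<circ> (p \<circ> u))) +
      pair_sum R (order_change (f \<circ> (p \<circ> u)) (f \<circ> Transposition.transpose a b \<circ> (p \<circ> u)))"
    using pair_sum_order_change_transpose[OF R w f swap.hyps(1-3)] swap.IH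
    by (simp only: comp_assoc)
  also have "\<dots> = pair_sum R (order_change (f \<circ> u) (f \<circ> Transposition.transpose a b \<circ> (p \<circ> u)))"
    by (simp only: order_change_trans flip: pair_sum_add)
  finally show ?case by (simp only: comp_assoc)
qed

subsection \<open>Relations between the parities of an orthogonal array\<close>

lemma orthogonal_arrayD:
  assumes "orthogonal_array k n \<Lambda> A"
  shows "finite \<Lambda>" "card \<Lambda> = n"
    and "\<And>r l. r \<in> {1..n^2} \<Longrightarrow> l \<in> {1..k} \<Longrightarrow> A r l \<in> \<Lambda>"
    and "\<And>i j x y. i \<in> {1..k} \<Longrightarrow> j \<in> {1..k} \<Longrightarrow> i \<noteq> j \<Longrightarrow> x \<in> \<Lambda> \<Longrightarrow> y \<in> \<Lambda>
      \<Longrightarrow> \<exists>!r. r \<in> {1..n^2} \<and> A r i = x \<and> A r j = y"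
  using assms unfolding orthogonal_array_def by blast+

lemma orthogonal_array_row_eq:
  assumes OA: "orthogonal_array k n \<Lambda> A" and ij: "i \<in> {1..k}" "j \<in> {1..k}" "i \<noteq> j"
    and r: "r \<in> {1..n^2}" "r' \<in> {1..n^2}" and eq: "A r i = A r' i" "A r j = A r' j"
  shows "r = r'"
proof -
  have "\<exists>!q. q \<in> {1..n^2} \<and> A q i = A r i \<and> A q j = A r j"
    using orthogonal_arrayD[OF OA] ij r by blast
  then show ?thesis using r eq by metis
qed

lemma orthogonal_array_line_bij:
  assumes OA: "orthogonal_array k n \<Lambda> A" and ij: "c \<in> {1..k}" "i \<in> {1..k}" "c \<noteq> i" and s: "s \<in> \<Lambda>"
  shows "bij_betw (\<lambda>r. A r i) {r \<in> {1..n^2}. A r c = s} \<Lambda>"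
  unfolding bij_betw_def
proof
  show "inj_on (\<lambda>r. A r i) {r \<in> {1..n^2}. A r c = s}"
    using orthogonal_array_row_eq[OF OA ij] by (auto intro!: inj_onI)
  have "x \<in> (\<lambda>r. A r i) ` {r \<in> {1..n^2}. A r c = s}" if "x \<in> \<Lambda>" for x
    using orthogonal_arrayD(4)[OF OA ij s that] by blast
  then show "(\<lambda>r. A r i) ` {r \<in> {1..n^2}. A r c = s} = \<Lambda>"
    using orthogonal_arrayD(3)[OF OA] ij by auto
qed

lemma orthogonal_array_pair_bij:
  assumes OA: "orthogonal_array k n \<Lambda> A" and ij: "i \<in> {1..k}" "j \<in> {1..k}" "i \<noteq> j"
  shows "bij_betw (\<lambda>r. (A r i, A r j)) {1..n^2} (\<Lambda> \<times> \<Lambda>)"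
  unfolding bij_betw_def
proof
  show "inj_on (\<lambda>r. (A r i, A r j)) {1..n^2}"
    using orthogonal_array_row_eq[OF OA ij] by (intro inj_onI) blast
  have "(x, y) \<in> (\<lambda>r. (A r i, A r j)) ` {1..n^2}" if "x \<in> \<Lambda>" "y \<in> \<Lambda>" for x y
    using orthogonal_arrayD(4)[OF OA ij that] by blast
  then show "(\<lambda>r. (A r i, A r j)) ` {1..n^2} = \<Lambda> \<times> \<Lambda>"
    using orthogonal_arrayD(3)[OF OA] ij by auto
qed

text \<open>In each of the \<open>n + 1\<close> columns exactly \<open>n - 1\<close> other rows
  agree with \<open>r\<close>, and these sets are disjoint. Their union has
  \<open>(n + 1) * (n - 1) = n^2 - 1\<close> elements, hence contains every other row.\<close>

lemma complete_orthogonal_array_rows_meet: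
  assumes OA: "orthogonal_array (n + 1) n \<Lambda> A"
    and r: "r \<in> {1..n^2}" "r' \<in> {1..n^2}" "r \<noteq> r'"
  shows "\<exists>c\<in>{1..n + 1}. A r c = A r' c"
proof -
  have n: "n \<ge> 1" using r by (cases n) auto
  define M where "M c = {q \<in> {1..n^2}. A q c = A r c} - {r}" for c
  have cardM: "card (M c) = n - 1" if c: "c \<in> {1..n + 1}" for c
  proof -
    \<comment> \<open>Any second column serves to parametrize the rows with a fixed entry in column
      \<open>c\<close>.\<close>
    obtain i where i: "i \<in> {1..n + 1}" "c \<noteq> i"
    proof (cases "c = 1")
      case True
      then show ?thesis using that[of 2] n by auto
    next
      case False
      then show ?thesis using that[of 1] by auto
    qed
    have "A r c \<in> \<Lambda>" using orthogonal_arrayD(3)[OF OA r(1) c] .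
    from orthogonal_array_line_bij[OF OA c i this]
    have "card {q \<in> {1..n^2}. A q c = A r c} = n"
      using orthogonal_arrayD(2)[OF OA] by (simp add: bij_betw_same_card)
    then show ?thesis using r by (simp add: M_def)
  qed
  have disj: "M c \<inter> M d = {}" if "c \<in> {1..n + 1}" "d \<in> {1..n + 1}" "c \<noteq> d" for c d
    using orthogonal_array_row_eq[OF OA that _ r(1)] unfolding M_def by blast
  have "card (\<Union>c\<in>{1..n + 1}. M c) = (\<Sum>c\<in>{1..n + 1}. card (M c))"
    using disj by (intro card_UN_disjoint) (auto simp: M_def)
  also have "\<dots> = (n + 1) * (n - 1)" using cardM by simp
  also have "\<dots> = card ({1..n^2} - {r})"
    using r n by (simp add: power2_eq_square algebra_simps)
  finally have "(\<Union>c\<in>{1..n + 1}. M c) = {1..n^2} - {r}"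
    by (intro card_subset_eq) (auto simp: M_def)
  then have "r' \<in> (\<Union>c\<in>{1..n + 1}. M c)" using r by blast
  then obtain c where "c \<in> {1..n + 1}" "A r' c = A r c" by (auto simp: M_def)
  then show ?thesis by metis
qed

text \<open>On the rows with entry \<open>s\<close> in column \<open>c\<close>, column
  \<open>i\<close> is a bijection onto \<open>\<Lambda>\<close> and \<open>rho\<close> carries it to
  column \<open>j\<close>, so the inversion count applies. Summing over \<open>s\<close> collects
  the fibres of column \<open>c\<close>.\<close>

lemma tau_eq_pair_sum:
  fixes f :: "'a \<Rightarrow> 'k::linorder"
  assumes OA: "orthogonal_array k n \<Lambda> A" and T: "(c, i, j) \<in> column_triples k"
    and f: "inj_on f \<Lambda>"
  shows "tau n \<Lambda> A c i j = pair_sum {1..n^2} (\<lambda>r r'. if A r c = A r' c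
    then order_change (\<lambda>q. f (A q i)) (\<lambda>q. f (A q j)) r r' else 0)"
proof -
  have c: "c \<in> {1..k}" "i \<in> {1..k}" "c \<noteq> i"
    using T by (auto simp: column_triples_def)
  have "perm_parity (rho n \<Lambda> A s c i j) = pair_sum {r \<in> {1..n^2}. A r c = s}
      (order_change (\<lambda>q. f (A q i)) (\<lambda>q. f (A q j)))" if s: "s \<in> \<Lambda>" for s
  proof -
    have "perm_parity (rho n \<Lambda> A s c i j) = pair_sum {r \<in> {1..n^2}. A r c = s}
      (order_change (f \<circ> (\<lambda>q. A q i)) (f \<circ> rho n \<Lambda> A s c i j \<circ> (\<lambda>q. A q i)))"
      using rho_permutes[OF OA T s] orthogonal_arrayD(1)[OF OA] orthogonal_array_line_bij[OF OA c s] f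
      by (rule perm_parity_eq_pair_sum)
    also have "\<dots> = pair_sum {r \<in> {1..n^2}. A r c = s}
      (order_change (\<lambda>q. f (A q i)) (\<lambda>q. f (A q j)))"
      using rho_entry[OF OA T] by (intro pair_sum_cong) (simp add: order_change_def)
    finally show ?thesis .
  qed
  then have "tau n \<Lambda> A c i j = (\<Sum>s\<in>\<Lambda>. pair_sum {r \<in> {1..n^2}. A r c = s}
      (order_change (\<lambda>q. f (A q i)) (\<lambda>q. f (A q j))))"
    by (simp add: tau_def)
  also have "\<dots> = pair_sum {1..n^2} (\<lambda>r r'. if A r c = A r' c
    then order_change (\<lambda>q. f (A q i)) (\<lambda>q. f (A q j)) r r' else 0)"
    using orthogonal_arrayD[OF OA] c by (intro pair_sum_fibres) auto
  finally show ?thesis .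
qed

lemma tau_commute:
  assumes OA: "orthogonal_array k n \<Lambda> A" and T: "(c, i, j) \<in> column_triples k"
  shows "tau n \<Lambda> A c i j = tau n \<Lambda> A c j i"
proof -
  obtain f :: "'a \<Rightarrow> nat" where f: "inj_on f \<Lambda>"
    using finite_imp_inj_to_nat_seg[OF orthogonal_arrayD(1)[OF OA]] by blast
  have T': "(c, j, i) \<in> column_triples k" using T by (auto simp: column_triples_def)
  show ?thesis
    unfolding tau_eq_pair_sum[OF OA T f] tau_eq_pair_sum[OF OA T' f]
    by (subst order_change_commute) (rule refl)
qed

lemma tau_trans:
  assumes OA: "orthogonal_array k n \<Lambda> A"
    and T: "(c, i, j) \<in> column_triples k" "(c, j, l) \<in> column_triples k" "(c, i, l) \<in> column_triples k"
  shows "tau n \<Lambda> A c i j + tau n \<Lambda> A c j l = tau n \<Lambda> A c i l"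
proof -
  obtain f :: "'a \<Rightarrow> nat" where f: "inj_on f \<Lambda>"
    using finite_imp_inj_to_nat_seg[OF orthogonal_arrayD(1)[OF OA]] by blast
  show ?thesis
    unfolding T[THEN tau_eq_pair_sum[OF OA _ f]] pair_sum_add[symmetric]
    by (intro pair_sum_cong) (auto simp only: order_change_trans add_0 split: if_split)
qed

text \<open>Excluding ties in either column makes the summand symmetric when \<open>f\<close> is
  injective on \<open>\<Lambda>\<close>, which permits reindexing the rows.\<close>

definition discordance :: "nat \<Rightarrow> ('a \<Rightarrow> nat) \<Rightarrow> (nat \<Rightarrow> nat \<Rightarrow> 'a) \<Rightarrow> nat \<Rightarrow> nat \<Rightarrow> bit" where
  "discordance n f A i j = pair_sum {1..n^2} (\<lambda>r r'. if A r i \<noteq> A r' i \<and> A r j \<noteq> A r' j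
    then order_change (\<lambda>q. f (A q i)) (\<lambda>q. f (A q j)) r r' else 0)"

lemma discordance_eq:
  assumes A: "orthogonal_array k n \<Lambda> A" and B: "orthogonal_array k n \<Lambda> B"
    and f: "inj_on f \<Lambda>" and ij: "i \<in> {1..k}" "j \<in> {1..k}" "i \<noteq> j"
  shows "discordance n f A i j = discordance n f B i j"
proof -
  let ?a = "\<lambda>r. (A r i, A r j)" and ?b = "\<lambda>r. (B r i, B r j)"
  let ?R = "{1..n^2}"
  \<comment> \<open>Sends a row of \<open>A\<close> to the row of \<open>B\<close> with the same
    entries in columns \<open>i\<close> and \<open>j\<close>.\<close>
  define g where "g = inv_into ?R ?b \<circ> ?a"
  have "bij_betw g ?R ?R"
    unfolding g_def using orthogonal_array_pair_bij[OF A ij] orthogonal_array_pair_bij[OF B ij]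
    by (blast intro: bij_betw_trans bij_betw_inv_into)
  then have g: "inj_on g ?R" "g ` ?R = ?R" by (auto simp: bij_betw_def)
  have bg: "?b (g r) = ?a r" if "r \<in> ?R" for r
  proof -
    have "?a r \<in> ?b ` ?R"
      using orthogonal_array_pair_bij[OF A ij] orthogonal_array_pair_bij[OF B ij] that
      unfolding bij_betw_def by blast
    then show ?thesis unfolding g_def comp_def by (rule f_inv_into_f)
  qed
  let ?\<phi> = "\<lambda>r r'. if B r i \<noteq> B r' i \<and> B r j \<noteq> B r' j
    then order_change (\<lambda>q. f (B q i)) (\<lambda>q. f (B q j)) r r' else 0"
  have "discordance n f B i j = pair_sum (g ` ?R) ?\<phi>"
    by (simp only: discordance_def g(2))
  also have "\<dots> = pair_sum ?R (\<lambda>r r'. ?\<phi> (g r) (g r'))"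
  proof (rule pair_sum_reindex)
    fix r r' assume "r \<in> g ` ?R" "r' \<in> g ` ?R"
    then have "B r i \<in> \<Lambda>" "B r' i \<in> \<Lambda>" "B r j \<in> \<Lambda>" "B r' j \<in> \<Lambda>"
      using g orthogonal_arrayD(3)[OF B] ij by blast+
    then show "?\<phi> r r' = ?\<phi> r' r"
      using order_change_sym[of "\<lambda>q. f (B q i)" r r' "\<lambda>q. f (B q j)"] f
      by (auto simp: inj_on_eq_iff)
  qed (use g in auto)
  also have "\<dots> = discordance n f A i j"
    unfolding discordance_def using bg by (intro pair_sum_cong) (simp add: order_change_def)
  finally show ?thesis by simp
qed

text \<open>Compare both sides on one pair of rows, which agrees in at most one of the three
  columns. If it agrees in one, the same single order change remains on both sides. If in none, the
  left is 0 and the right is the sum of all three order changes, which cancels.\<close>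

lemma tau_triangle:
  assumes OA: "orthogonal_array k n \<Lambda> A" and T: "(c, i, j) \<in> column_triples k" and f: "inj_on f \<Lambda>"
  shows "tau n \<Lambda> A c i j + tau n \<Lambda> A i c j + tau n \<Lambda> A j c i =
    discordance n f A i j + discordance n f A c j + discordance n f A c i"
proof -
  have T': "(i, c, j) \<in> column_triples k" "(j, c, i) \<in> column_triples k"
    using T by (auto simp: column_triples_def)
  have c: "c \<in> {1..k}" "i \<in> {1..k}" "j \<in> {1..k}" "c \<noteq> i" "c \<noteq> j" "i \<noteq> j"
    using T by (auto simp: column_triples_def)
  show ?thesis
    unfolding discordance_def tau_eq_pair_sum[OF OA T f] T'[THEN tau_eq_pair_sum[OF OA _ f]]
      pair_sum_add[symmetric]
  proof (rule pair_sum_cong, goal_cases)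
    case (1 r r')
    have "\<not> (A r c = A r' c \<and> A r i = A r' i)" "\<not> (A r c = A r' c \<and> A r j = A r' j)"
      "\<not> (A r i = A r' i \<and> A r j = A r' j)"
      using orthogonal_array_row_eq[OF OA _ _ _ 1(1,2)] 1(3) c by blast+
    moreover have "order_change (\<lambda>q. f (A q i)) (\<lambda>q. f (A q j)) r r' +
        order_change (\<lambda>q. f (A q c)) (\<lambda>q. f (A q j)) r r' +
        order_change (\<lambda>q. f (A q c)) (\<lambda>q. f (A q i)) r r' = 0"
      by (auto simp: order_change_def of_bool_def)
    ultimately show ?case by auto
  qed
qed

text \<open>The unique column in which two rows agree lies outside \<open>{i, j}\<close> exactly
  when the rows differ in both \<open>i\<close> and \<open>j\<close>.\<close>

lemma tau_column_sum:
  assumes OA: "orthogonal_array (n + 1) n \<Lambda> A" and f: "inj_on f \<Lambda>"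
    and ij: "i \<in> {1..n + 1}" "j \<in> {1..n + 1}" "i \<noteq> j"
  shows "(\<Sum>c\<in>{1..n + 1} - {i, j}. tau n \<Lambda> A c i j) = discordance n f A i j"
proof -
  let ?d = "order_change (\<lambda>q. f (A q i)) (\<lambda>q. f (A q j))"
  let ?C = "{1..n + 1} - {i, j}"
  have "(\<Sum>c\<in>?C. tau n \<Lambda> A c i j) =
      (\<Sum>c\<in>?C. pair_sum {1..n^2} (\<lambda>r r'. if A r c = A r' c then ?d r r' else 0))"
    using ij by (intro sum.cong tau_eq_pair_sum[OF OA _ f]) (auto simp: column_triples_def)
  also have "\<dots> = pair_sum {1..n^2} (\<lambda>r r'. \<Sum>c\<in>?C. if A r c = A r' c then ?d r r' else 0)"
    by (simp add: pair_sum_sum)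
  also have "\<dots> = discordance n f A i j"
    unfolding discordance_def
  proof (rule pair_sum_cong)
    fix r r' assume r: "r \<in> {1..n^2}" "r' \<in> {1..n^2}" "r \<noteq> r'"
    obtain c where c: "c \<in> {1..n + 1}" "A r c = A r' c"
      using complete_orthogonal_array_rows_meet[OF OA r] by blast
    have uniq: "A r d = A r' d \<longleftrightarrow> d = c" if "d \<in> {1..n + 1}" for d
      using orthogonal_array_row_eq[OF OA that c(1) _ r(1,2)] r(3) c(2) by blast
    have "(\<Sum>d\<in>?C. if A r d = A r' d then ?d r r' else 0) = (\<Sum>d\<in>?C. if d = c then ?d r r' else 0)"
      using uniq by (intro sum.cong) auto
    also have "\<dots> = (if c \<in> ?C then ?d r r' else 0)" by simp
    finally show "(\<Sum>d\<in>?C. if A r d = A r' d then ?d r r' else 0) =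
        (if A r i \<noteq> A r' i \<and> A r j \<noteq> A r' j then ?d r r' else 0)"
      using uniq ij c by auto
  qed
  finally show ?thesis .
qed

subsection \<open>Coordinates that determine the parity\<close>

text \<open>
  Applied to the difference of the \<open>\<tau>\<close>-parities of two arrays, for which the relations are homogeneous.
\<close>
lemma parity_relations_vanish:
  fixes D :: "nat \<Rightarrow> nat \<Rightarrow> nat \<Rightarrow> bit"
  assumes n: "n \<ge> 2" and K: "K = n + 1"
    and commute: "\<And>c i j. (c, i, j) \<in> column_triples K \<Longrightarrow> D c i j = D c j i"
    and trans: "\<And>c i j l. (c, i, j) \<in> column_triples K \<Longrightarrow> (c, j, l) \<in> column_triples K \<Longrightarrow>
      (c, i, l) \<in> column_triples K \<Longrightarrow> D c i j + D c j l = D c i l"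
    and triangle: "\<And>c i j. (c, i, j) \<in> column_triples K \<Longrightarrow> D c i j + D i c j + D j c i = 0"
    and column: "\<And>j. j \<in> {1..n} \<Longrightarrow> (\<Sum>c\<in>{1..n} - {j}. D c K j) = 0"
    and zero1: "\<And>j. 2 \<le> j \<Longrightarrow> j < n \<Longrightarrow> D K 1 j = 0"
    and zero2: "odd n \<Longrightarrow> D K 1 n = 0"
    and zero3: "\<And>i j. 2 \<le> i \<Longrightarrow> i < j \<Longrightarrow> j \<le> n \<Longrightarrow> D i K j = 0"
    and T: "(c, i, j) \<in> column_triples K"
  shows "D c i j = 0"
proof -
  \<comment> \<open>The one value among the coordinates that is not assumed to vanish for even
    \<open>n\<close>; the values \<open>D i K j\<close> are first expressed through it.\<close>
  define w where "w = D K 1 n"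
  have v: "D K 1 j = (if j = n then w else 0)" if "j \<in> {2..n}" for j
    using zero1[of j] that by (auto simp: w_def)
  \<comment> \<open>The triangle relation with third column \<open>K\<close>, solved for
    \<open>D i K j\<close>.\<close>
  have swap: "D i K j = D K i j + D j K i" if "i \<in> {1..n}" "j \<in> {1..n}" "i \<noteq> j" for i j
  proof -
    have "D K i j + D i K j + D j K i = 0"
      using that K by (intro triangle) (auto simp: column_triples_def)
    then show ?thesis by (cases "D K i j"; cases "D i K j"; cases "D j K i") simp_all
  qed
  have inner: "D i K j = (if i = n then w else 0)"
    if "i \<in> {2..n}" "j \<in> {2..n}" "i \<noteq> j" for i j
  proof (cases "i < j")
    case True
    then show ?thesis using that zero3[of i j] by auto
  next
    case False
    \<comment> \<open>For \<open>i > j\<close> the value \<open>D K i j\<close> is reached through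
      column 1; here \<open>j < n\<close>, so only \<open>i = n\<close> can bring in
      \<open>w\<close>.\<close>
    have "D K 1 i + D K i j = D K 1 j"
      using that K by (intro trans) (auto simp: column_triples_def)
    moreover have "D i K j = D K i j + D j K i" using that by (intro swap) auto
    moreover have "D j K i = 0" using False that zero3[of j i] by auto
    moreover have "D K 1 i = (if i = n then w else 0)" "D K 1 j = 0"
      using v[of i] v[of j] that False by auto
    ultimately show ?thesis by (auto simp: bit_add_eq_0_iff)
  qed
  have first: "D 1 K j = (if j = n then 0 else w)" if j: "j \<in> {2..n}" for j
  proof -
    \<comment> \<open>The column relation for \<open>j\<close> isolates \<open>D 1 K j\<close>;
      among the remaining terms only \<open>c = n\<close> can contribute.\<close>
    have "{1..n} - {j} = insert 1 ({2..n} - {j})" using j by auto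
    then have "D 1 K j + (\<Sum>c\<in>{2..n} - {j}. D c K j) = 0"
      using column[of j] j by simp
    moreover have "(\<Sum>c\<in>{2..n} - {j}. D c K j) = (\<Sum>c\<in>{2..n} - {j}. if c = n then w else 0)"
      using inner j by (intro sum.cong) auto
    ultimately have "D 1 K j = (\<Sum>c\<in>{2..n} - {j}. if c = n then w else 0)"
      by (simp only: bit_add_eq_0_iff)
    then show ?thesis using n by simp
  qed
  have last: "D j K 1 = w" if j: "j \<in> {2..n}" for j
  proof -
    have "D 1 K j = D K 1 j + D j K 1" using j by (intro swap) auto
    then show ?thesis using first[OF j] v[OF j] by (cases "D j K 1"; cases w) (auto split: if_splits)
  qed
  have "w = 0"
  proof (cases "odd n")
    case True
    then show ?thesis using zero2 by (simp add: w_def)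
  next
    case False
    \<comment> \<open>For even \<open>n\<close> the column relation for \<open>j = 1\<close> adds
      \<open>n - 1\<close> copies of \<open>w\<close>, an odd number, so \<open>w\<close>
      vanishes.\<close>
    have "{1..n} - {1} = {2..n}" by auto
    then have "(\<Sum>j\<in>{2..n}. D j K 1) = 0" using column[of 1] n by simp
    then have "of_nat (n - 1) * w = 0" using last by simp
    moreover have "odd (n - 1)" using False n by simp
    then have "of_nat (n - 1) = (1 :: bit)" by (metis bit_not_zero_iff even_of_nat even_zero)
    ultimately show ?thesis by simp
  qed
  then have e: "D i K j = 0" if "i \<in> {1..n}" "j \<in> {1..n}" "i \<noteq> j" for i j
  proof -
    consider "i = 1" "j \<in> {2..n}" | "j = 1" "i \<in> {2..n}" | "i \<in> {2..n}" "j \<in> {2..n}"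
      using \<open>i \<in> {1..n}\<close> \<open>j \<in> {1..n}\<close> \<open>i \<noteq> j\<close> by fastforce
    then show ?thesis using first last inner \<open>w = 0\<close> \<open>i \<noteq> j\<close> by cases auto
  qed
  have T': "c \<in> {1..n + 1}" "i \<in> {1..n + 1}" "j \<in> {1..n + 1}" "c \<noteq> i" "c \<noteq> j" "i \<noteq> j"
    using T K by (auto simp: column_triples_def)
  \<comment> \<open>With \<open>K\<close> as first index \<open>swap\<close> applies; if
    \<open>K\<close> is absent, the step from \<open>i\<close> to \<open>j\<close> is routed through
    \<open>K\<close>.\<close>
  consider "c = K" | "i = K" "c \<in> {1..n}" "j \<in> {1..n}" | "j = K" "c \<in> {1..n}" "i \<in> {1..n}"
    | "c \<in> {1..n}" "i \<in> {1..n}" "j \<in> {1..n}"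
    using T' K by fastforce
  then show ?thesis
  proof cases
    case 1
    then have "i \<in> {1..n}" "j \<in> {1..n}" using T' K by auto
    then show ?thesis using swap[of i j] e[of i j] e[of j i] T' 1 by simp
  next
    case 2
    then show ?thesis using e T' by simp
  next
    case 3
    then show ?thesis using e commute[OF T] T' by simp
  next
    case 4
    have "D c i K + D c K j = D c i j"
      using 4 T' K by (intro trans) (auto simp: column_triples_def)
    moreover have "D c i K = D c K i"
      using 4 T' K by (intro commute) (auto simp: column_triples_def)
    ultimately show ?thesis using e 4 T' by simp
  qed
qed

text \<open>
  The pairs \<open>(1, j)\<close> are free to encode \<open>\<tau>\<^sup>K\<^sub>1\<^sub>j\<close>, so that the coordinates are indexed by
  the pairs \<open>i < j\<close> in \<open>{1..n}\<close>.
\<close>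
definition coordinate :: "nat \<Rightarrow> nat \<times> nat \<Rightarrow> nat \<times> nat \<times> nat" where
  "coordinate n = (\<lambda>(i, j). if i = 1 then (n + 1, 1, j) else (i, n + 1, j))"

text \<open>Listing the larger index first makes the count a sum of \<open>j - 1\<close>; the
  converse restores the order \<open>(i, j)\<close>. The pair removed for even \<open>n\<close>
  encodes the value that the column relations force.\<close>

definition coordinates :: "nat \<Rightarrow> (nat \<times> nat) set" where
  "coordinates n = (SIGMA j:{1..n}. {1..<j})\<inverse> - (if even n then {(1, n)} else {})"

lemma card_coordinates:
  assumes "n \<ge> 2"
  shows "card (coordinates n) = (if even n then (n choose 2) - 1 else n choose 2)"
proof -
  have "card (SIGMA j:{1..n}. {1..<j}) = (\<Sum>j\<in>{1..n}. j - 1)"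
    by simp
  also have "\<dots> = n choose 2"
    by (induction n) (auto simp: numeral_2_eq_2)
  finally have "card ((SIGMA j:{1..n}. {1..<j})\<inverse>) = n choose 2"
    by (simp add: card_inverse)
  moreover have "(1, n) \<in> (SIGMA j:{1..n}. {1..<j})\<inverse>" using assms by auto
  ultimately show ?thesis by (simp add: coordinates_def)
qed

lemma finite_coordinates: "finite (coordinates n)"
  by (simp add: coordinates_def)

lemma tau_parity_eqI:
  assumes n: "n \<ge> 2" and A: "orthogonal_array (n + 1) n \<Lambda> A" and B: "orthogonal_array (n + 1) n \<Lambda> B"
    and eq: "\<And>p. p \<in> coordinates n \<Longrightarrow>
      tau_parity (n + 1) n \<Lambda> A (coordinate n p) = tau_parity (n + 1) n \<Lambda> B (coordinate n p)"
  shows "tau_parity (n + 1) n \<Lambda> A = tau_parity (n + 1) n \<Lambda> B"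
proof -
  obtain f :: "'a \<Rightarrow> nat" where f: "inj_on f \<Lambda>"
    using finite_imp_inj_to_nat_seg[OF orthogonal_arrayD(1)[OF A]] by blast
  \<comment> \<open>In \<open>bit\<close> this sum is the difference, and the discordances common to
    both arrays cancel in it.\<close>
  define D where "D c i j = tau n \<Lambda> A c i j + tau n \<Lambda> B c i j" for c i j
  have eq': "D c i j = 0" if "(c, i, j) = coordinate n p" "p \<in> coordinates n" for c i j p
  proof -
    have "(c, i, j) \<in> column_triples (n + 1)"
      using that by (auto simp: column_triples_def coordinate_def coordinates_def split: if_splits)
    then show ?thesis using eq[OF that(2)] that(1)[symmetric] by (simp add: tau_parity_def D_def)
  qed
  have d: "discordance n f A i j = discordance n f B i j"
    if "i \<in> {1..n + 1}" "j \<in> {1..n + 1}" "i \<noteq> j" for i j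
    using discordance_eq[OF A B f that] .
  have "D c i j = 0" if T: "(c, i, j) \<in> column_triples (n + 1)" for c i j
  proof (rule parity_relations_vanish[OF n refl _ _ _ _ _ _ _ T])
    fix c i j assume "(c, i, j) \<in> column_triples (n + 1)"
    then show "D c i j = D c j i"
      unfolding D_def using tau_commute A B by metis
  next
    fix c i j l
    assume t: "(c, i, j) \<in> column_triples (n + 1)" "(c, j, l) \<in> column_triples (n + 1)"
      "(c, i, l) \<in> column_triples (n + 1)"
    show "D c i j + D c j l = D c i l"
      unfolding D_def tau_trans[OF A t, symmetric] tau_trans[OF B t, symmetric]
      by (simp only: ac_simps)
  next
    fix c i j assume t: "(c, i, j) \<in> column_triples (n + 1)"
    then have "c \<in> {1..n + 1}" "i \<in> {1..n + 1}" "j \<in> {1..n + 1}" "c \<noteq> i" "c \<noteq> j" "i \<noteq> j"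
      by (auto simp: column_triples_def)
    then have "(tau n \<Lambda> A c i j + tau n \<Lambda> A i c j + tau n \<Lambda> A j c i) +
        (tau n \<Lambda> B c i j + tau n \<Lambda> B i c j + tau n \<Lambda> B j c i) = 0"
      unfolding tau_triangle[OF A t f] tau_triangle[OF B t f] by (simp add: d)
    then show "D c i j + D i c j + D j c i = 0"
      unfolding D_def by (simp only: ac_simps)
  next
    fix j assume j: "j \<in> {1..n}"
    then have *: "n + 1 \<in> {1..n + 1}" "j \<in> {1..n + 1}" "n + 1 \<noteq> j" by auto
    have "{1..n + 1} - {n + 1, j} = {1..n} - {j}" by auto
    then show "(\<Sum>c\<in>{1..n} - {j}. D c (n + 1) j) = 0"
      unfolding D_def sum.distrib bit_add_eq_0_iff
      using tau_column_sum[OF A f *] tau_column_sum[OF B f *] d[OF *] by simp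
  next
    fix j assume "2 \<le> j" "j < n"
    then show "D (n + 1) 1 j = 0"
      by (intro eq'[of _ _ _ "(1, j)"]) (auto simp: coordinate_def coordinates_def)
  next
    assume "odd n"
    then show "D (n + 1) 1 n = 0"
      using n by (intro eq'[of _ _ _ "(1, n)"]) (auto simp: coordinate_def coordinates_def)
  next
    fix i j assume "2 \<le> i" "i < j" "j \<le> n"
    then show "D i (n + 1) j = 0"
      by (intro eq'[of _ _ _ "(i, j)"]) (auto simp: coordinate_def coordinates_def)
  qed
  then show ?thesis
    unfolding tau_parity_def D_def bit_add_eq_0_iff by (intro restrict_ext) auto
qed

text \<open>Restriction to the coordinates is injective on parities by
  \<open>tau_parity_eqI\<close>, and its values are bit vectors indexed by
  \<open>coordinates n\<close>.\<close>

lemma card_tau_parities_le: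
  assumes "n \<ge> 2"
  shows "card (tau_parities (n + 1) n \<Lambda>) \<le> 2 ^ card (coordinates n)"
proof -
  let ?code = "\<lambda>t. \<lambda>p\<in>coordinates n. t (coordinate n p)"
  have "inj_on ?code (tau_parities (n + 1) n \<Lambda>)"
  proof (rule inj_onI)
    fix t t' assume "t \<in> tau_parities (n + 1) n \<Lambda>" "t' \<in> tau_parities (n + 1) n \<Lambda>"
      and code: "?code t = ?code t'"
    moreover have "t (coordinate n p) = t' (coordinate n p)" if "p \<in> coordinates n" for p
      using fun_cong[OF code, of p] that by simp
    ultimately show "t = t'"
      unfolding tau_parities_def using tau_parity_eqI[OF assms] by blast
  qed
  moreover have "?code ` tau_parities (n + 1) n \<Lambda> \<subseteq> coordinates n \<rightarrow>\<^sub>E (UNIV :: bit set)"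
    by (intro image_subsetI) (simp only: restrict_PiE_iff UNIV_I ball_triv simp_thms)
  moreover have "finite (coordinates n \<rightarrow>\<^sub>E (UNIV :: bit set))"
    using card_bit by (intro finite_PiE finite_coordinates card_ge_0_finite) simp
  ultimately have "card (tau_parities (n + 1) n \<Lambda>) \<le> card (coordinates n \<rightarrow>\<^sub>E (UNIV :: bit set))"
    by (rule card_inj_on_le)
  then show ?thesis by (simp add: card_PiE finite_coordinates card_bit)
qed

theorem corollary5p6:
  fixes n :: nat and \<Lambda> :: "'a set"
  assumes "n \<ge> 2" and "finite \<Lambda>" and "card \<Lambda> = n"
  shows "(odd n \<longrightarrow> \<B> (n + 1) n \<Lambda> \<le> ereal (real (n choose 2))) \<and>
         (even n \<longrightarrow> \<B> (n + 1) n \<Lambda> \<le> ereal (real (n choose 2) - 1))"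
proof -
  have "\<B> (n + 1) n \<Lambda> \<le> ereal (real (card (coordinates n)))"
  proof (cases "tau_parities (n + 1) n \<Lambda> = {}")
    case True
    then show ?thesis by (simp add: \<B>_def)
  next
    case False
    then have "card (tau_parities (n + 1) n \<Lambda>) > 0"
      by (simp add: card_gt_0_iff finite_tau_parities)
    moreover have "real (card (tau_parities (n + 1) n \<Lambda>)) \<le> 2 ^ card (coordinates n)"
      using card_tau_parities_le[OF assms(1), of \<Lambda>] by (metis of_nat_le_iff of_nat_numeral of_nat_power)
    ultimately have "log 2 (real (card (tau_parities (n + 1) n \<Lambda>))) \<le> real (card (coordinates n))"
      by (subst log_le_iff) (simp_all add: powr_realpow)
    then show ?thesis using False by (simp add: \<B>_def)
  qed
  \<comment> \<open>Makes the truncated subtraction in \<open>card_coordinates\<close> agree with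
    the real one.\<close>
  moreover have "n choose 2 \<ge> 1"
    using assms(1) by (simp add: Suc_le_eq)
  ultimately show ?thesis
    using card_coordinates[OF assms(1)] by (auto simp: of_nat_diff)
qed

end
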